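(* Let $r,k,n$ be integers with $r\ge k\ge 2$ and $n\ge 1$, and let $S\subseteq [n]$ with $|S|\ge k$. Then \[ g_{r,k}(S)\ \ge\ f^{<k}(r,S)\ =\ \sum_{t=1}^{k-1}\left(t^{|S|}\sum_{j=t}^{k-1}\binom{r}{j}\binom{j}{j-t}(-1)^{j-t}\right). \]
   Context: $[n]=\{1,2,\dots,n\}$. A $k$-term arithmetic progression ($k$-AP) in a set $S\subseteq[n]$ is a set of $k$ distinct elements of $S$ of the form $\{a,a+d,\dots,a+(k-1)d\}$ with difference $d\in[n]$ (so $d\ge 1$). An $r$-coloring of $S$ is a map $\chi:S\to[r]$. A $k$-AP in $S$ is rainbow under $\chi$ if its $k$ elements receive pairwise distinct colors. An $r$-coloring of $S$ is rainbow $k$-AP-free if no $k$-AP in $S$ is rainbow. $g_{r,k}(S)$ denotes the number of rainbow $k$-AP-free $r$-colorings of $S$. $f^{<k}(r,S)$ denotes the number of $r$-colorings $\chi:S\to[r]$ using at most $k-1$ colors, i.e. with $|\chi(S)|\le k-1$. *)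

theory Defs
  imports Main "HOL-Library.FuncSet"
begin

text \<open>The parameter \<open>n\<close> is the ambient bound with \<open>S \<subseteq> {1..n}\<close>;
  it only limits the difference of a progression.\<close>

definition aps :: "nat \<Rightarrow> nat \<Rightarrow> nat set \<Rightarrow> nat set set" where
  "aps n k S = {P. P \<subseteq> S \<and> card P = k \<and>
     (\<exists>a. \<exists>d\<in>{1..n}. P = (\<lambda>i. a + i * d) ` {..<k})}"

text \<open>Extensional functions are used so that a map from \<open>S\<close> to \<open>{1..r}\<close> is
  counted exactly once.\<close>

definition colorings :: "nat \<Rightarrow> nat set \<Rightarrow> (nat \<Rightarrow> nat) set" where
  "colorings r S = S \<rightarrow>\<^sub>E {1..r}"

definition rainbow :: "(nat \<Rightarrow> nat) \<Rightarrow> nat set \<Rightarrow> bool" where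
  "rainbow \<chi> P \<longleftrightarrow> inj_on \<chi> P"

definition rainbow_ap_free :: "nat \<Rightarrow> nat \<Rightarrow> nat set \<Rightarrow> (nat \<Rightarrow> nat) \<Rightarrow> bool" where
  "rainbow_ap_free n k S \<chi> \<longleftrightarrow> (\<forall>P\<in>aps n k S. \<not> rainbow \<chi> P)"

definition num_rainbow_ap_free :: "nat \<Rightarrow> nat \<Rightarrow> nat \<Rightarrow> nat set \<Rightarrow> nat" where
  "num_rainbow_ap_free n r k S = card {\<chi> \<in> colorings r S. rainbow_ap_free n k S \<chi>}"

definition num_few_colors :: "nat \<Rightarrow> nat \<Rightarrow> nat set \<Rightarrow> nat" where
  "num_few_colors k r S = card {\<chi> \<in> colorings r S. card (\<chi> ` S) \<le> k - 1}"

end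

theory Submission
  imports Defs
begin

text \<open>
  The inequality holds because a rainbow \<open>k\<close>-term progression in \<open>S\<close> shows \<open>k\<close> different colours:
  a colouring with at most \<open>k - 1\<close> colours has none of them.

  For the formula, sort the colourings with few colours by the set \<open>B \<subseteq> {1..r}\<close> of colours that
  occur. The colourings with colour set exactly \<open>B\<close> are the surjections \<open>S \<rightarrow> B\<close>. Every map
  \<open>S \<rightarrow> B\<close> is a surjection onto a unique subset of \<open>B\<close>, and there are \<open>card B ^ card S\<close> maps, so
  Moebius inversion on the subset lattice (\<open>inclusion_exclusion_mobius\<close>) gives
  \<open>\<Sum>t\<le>j. (-1) ^ (j - t) * (j choose t) * t ^ card S\<close> surjections for \<open>card B = j\<close>
  (lemma \<open>card_surjections\<close>). There are \<open>r choose j\<close> sets \<open>B\<close> of size \<open>j\<close>; summing over \<open>j < k\<close> and exchanging the two sums gives the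
  result. The terms with \<open>t = 0\<close> or \<open>j = 0\<close> vanish, since \<open>S\<close> is nonempty.
\<close>

lemma sum_subsets_by_card:
  fixes g :: "nat \<Rightarrow> 'b::comm_semiring_1"
  assumes "finite A" and "finite J"
  shows "(\<Sum>B | B \<subseteq> A \<and> card B \<in> J. g (card B)) = (\<Sum>j\<in>J. of_nat (card A choose j) * g j)"
proof -
  have "finite {B. B \<subseteq> A \<and> card B \<in> J}"
    using assms(1) by simp
  then have "(\<Sum>B | B \<subseteq> A \<and> card B \<in> J. g (card B)) =
      (\<Sum>j\<in>J. \<Sum>B | B \<in> {B. B \<subseteq> A \<and> card B \<in> J} \<and> card B = j. g (card B))"
    using assms(2) by (intro sum.group[symmetric]) auto
  also have "\<dots> = (\<Sum>j\<in>J. of_nat (card A choose j) * g j)"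
  proof (intro sum.cong refl)
    fix j assume "j \<in> J"
    then have "{B \<in> {B. B \<subseteq> A \<and> card B \<in> J}. card B = j} = {B. B \<subseteq> A \<and> card B = j}"
      by auto
    then show "(\<Sum>B | B \<in> {B. B \<subseteq> A \<and> card B \<in> J} \<and> card B = j. g (card B)) =
        of_nat (card A choose j) * g j"
      by (simp add: n_subsets[OF assms(1)])
  qed
  finally show ?thesis .
qed

lemma card_funcset_by_image:
  assumes "finite S" and "finite B"
  shows "card {f \<in> S \<rightarrow>\<^sub>E B. P (f ` S)} =
    (\<Sum>C | C \<subseteq> B \<and> P C. card {f \<in> S \<rightarrow>\<^sub>E C. f ` S = C})"
proof -
  have "{f \<in> S \<rightarrow>\<^sub>E B. P (f ` S)} =
      (\<Union>C\<in>{C. C \<subseteq> B \<and> P C}. {f \<in> S \<rightarrow>\<^sub>E C. f ` S = C})"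
    by (force simp: PiE_iff)
  moreover have "\<forall>C\<in>{C. C \<subseteq> B \<and> P C}. finite {f \<in> S \<rightarrow>\<^sub>E C. f ` S = C}"
  proof
    fix C assume "C \<in> {C. C \<subseteq> B \<and> P C}"
    then have "finite (S \<rightarrow>\<^sub>E C)"
      using assms by (auto intro: finite_PiE finite_subset)
    then show "finite {f \<in> S \<rightarrow>\<^sub>E C. f ` S = C}"
      by simp
  qed
  ultimately show ?thesis
    using assms by (simp add: card_UN_disjoint disjoint_iff)
qed

text \<open>The identity \<open>card B ^ card S = (\<Sum>C\<in>Pow B. number of surjections S \<rightarrow> C)\<close> is the hypothesis
  of Moebius inversion; the inverted sum depends only on cardinalities of subsets.\<close>

lemma card_surjections:
  fixes S :: "'a set" and B :: "'b set"
  assumes "finite S" and "finite B"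
  shows "int (card {f \<in> S \<rightarrow>\<^sub>E B. f ` S = B}) =
    (\<Sum>t\<le>card B. int (card B choose t) * ((-1) ^ (card B - t) * int t ^ card S))"
proof -
  have "int (card {f \<in> S \<rightarrow>\<^sub>E B. f ` S = B}) =
      (\<Sum>C\<in>Pow B. (-1) ^ (card B - card C) * int (card C) ^ card S)"
  proof (rule inclusion_exclusion_mobius[OF _ assms(2)])
    fix C :: "'b set"
    assume "finite C"
    then have "card (S \<rightarrow>\<^sub>E C) = (\<Sum>D\<in>Pow C. card {f \<in> S \<rightarrow>\<^sub>E D. f ` S = D})"
      using card_funcset_by_image[OF assms(1), of C "\<lambda>_. True"] by (simp add: Pow_def)
    then show "int (card C) ^ card S = (\<Sum>D\<in>Pow C. int (card {f \<in> S \<rightarrow>\<^sub>E D. f ` S = D}))"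
      by (simp add: card_funcsetE[OF assms(1)] flip: of_nat_sum of_nat_power)
  qed
  also have "Pow B = {C. C \<subseteq> B \<and> card C \<in> {..card B}}"
    using assms(2) by (auto intro: card_mono)
  also have "(\<Sum>C\<in>\<dots>. (-1) ^ (card B - card C) * int (card C) ^ card S) =
      (\<Sum>t\<le>card B. int (card B choose t) * ((-1) ^ (card B - t) * int t ^ card S))"
    using sum_subsets_by_card[OF assms(2), of "{..card B}"
        "\<lambda>t. (-1) ^ (card B - t) * int t ^ card S"] by simp
  finally show ?thesis .
qed

lemma few_colors_imp_rainbow_ap_free:
  assumes "finite S" and "card (\<chi> ` S) < k"
  shows "rainbow_ap_free n k S \<chi>"
  unfolding rainbow_ap_free_def rainbow_def
proof (intro ballI notI)
  fix P assume "P \<in> aps n k S" and "inj_on \<chi> P"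
  then have "P \<subseteq> S" and "card (\<chi> ` P) = k"
    by (auto simp: aps_def card_image)
  then show False
    using assms card_mono[of "\<chi> ` S" "\<chi> ` P"] by (simp add: image_mono)
qed

lemma num_few_colors_eq:
  assumes "finite S" and "S \<noteq> {}"
  shows "int (num_few_colors k r S) =
    (\<Sum>t=1..k-1. int t ^ card S *
      (\<Sum>j=t..k-1. int (r choose j) * int (j choose (j - t)) * (-1) ^ (j - t)))"
proof -
  define surj_count where
    "surj_count j = (\<Sum>t\<le>j. int (j choose t) * ((-1) ^ (j - t) * int t ^ card S))" for j
  have pos: "card S > 0"
    using assms by (simp add: card_gt_0_iff)
  have "int (num_few_colors k r S) =
      int (card {f \<in> S \<rightarrow>\<^sub>E {1..r}. card (f ` S) \<in> {..k-1}})"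
    by (simp add: num_few_colors_def colorings_def)
  also have "\<dots> = (\<Sum>B | B \<subseteq> {1..r} \<and> card B \<in> {..k-1}. int (card {f \<in> S \<rightarrow>\<^sub>E B. f ` S = B}))"
    by (subst card_funcset_by_image[OF assms(1)]) auto
  also have "\<dots> = (\<Sum>B | B \<subseteq> {1..r} \<and> card B \<in> {..k-1}. surj_count (card B))"
    unfolding surj_count_def
    by (intro sum.cong refl card_surjections assms(1)) (auto dest: finite_subset)
  also have "\<dots> = (\<Sum>j\<le>k-1. int (r choose j) * surj_count j)"
    by (subst sum_subsets_by_card) auto
  also have "\<dots> = (\<Sum>j=1..k-1. int (r choose j) * surj_count j)"
    using pos by (intro sum.mono_neutral_right) (auto simp: surj_count_def not_less_eq_eq)
  also have "\<dots> = (\<Sum>j=1..k-1. \<Sum>t=1..j. int t ^ card S *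
      (int (r choose j) * int (j choose (j - t)) * (-1) ^ (j - t)))"
  proof (intro sum.cong refl)
    fix j
    have "surj_count j = (\<Sum>t=1..j. int (j choose t) * ((-1) ^ (j - t) * int t ^ card S))"
      unfolding surj_count_def
      using pos by (intro sum.mono_neutral_right) (auto simp: not_less_eq_eq)
    then show "int (r choose j) * surj_count j = (\<Sum>t=1..j. int t ^ card S *
        (int (r choose j) * int (j choose (j - t)) * (-1) ^ (j - t)))"
      by (auto simp: sum_distrib_left mult_ac binomial_symmetric[symmetric] intro!: sum.cong)
  qed
  also have "\<dots> = (\<Sum>t=1..k-1. \<Sum>j=t..k-1. int t ^ card S *
      (int (r choose j) * int (j choose (j - t)) * (-1) ^ (j - t)))"
    by (subst (1 2) sum.Sigma)
       (auto intro!: sum.reindex_bij_witness[of _ prod.swap prod.swap])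
  finally show ?thesis
    by (simp add: sum_distrib_left)
qed

theorem theorem1p2:
  fixes r k n :: nat and S :: "nat set"
  assumes "k \<ge> 2" and "r \<ge> k" and "n \<ge> 1"
    and "S \<subseteq> {1..n}" and "card S \<ge> k"
  shows "num_rainbow_ap_free n r k S \<ge> num_few_colors k r S \<and>
    int (num_few_colors k r S) =
      (\<Sum>t=1..k-1. int t ^ card S *
        (\<Sum>j=t..k-1. int (r choose j) * int (j choose (j - t)) * (-1) ^ (j - t)))"
proof
  have "finite S"
    using assms(4) finite_subset by blast
  have "finite (colorings r S)"
    using \<open>finite S\<close> by (simp add: colorings_def finite_PiE)
  moreover have "{\<chi> \<in> colorings r S. card (\<chi> ` S) \<le> k - 1} \<subseteq>
      {\<chi> \<in> colorings r S. rainbow_ap_free n k S \<chi>}"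
    using few_colors_imp_rainbow_ap_free[OF \<open>finite S\<close>] assms(1) by fastforce
  ultimately show "num_rainbow_ap_free n r k S \<ge> num_few_colors k r S"
    unfolding num_rainbow_ap_free_def num_few_colors_def by (intro card_mono) auto
  have "S \<noteq> {}"
    using assms(1,5) by auto
  then show "int (num_few_colors k r S) =
      (\<Sum>t=1..k-1. int t ^ card S *
        (\<Sum>j=t..k-1. int (r choose j) * int (j choose (j - t)) * (-1) ^ (j - t)))"
    by (rule num_few_colors_eq[OF \<open>finite S\<close>])
qed

end
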